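(* Let $S$ be a $\pi$-regular semiring. Then each element of $S$ is either a unit or multiplicatively non-cancellative.
   Context: A semiring is an algebraic structure $(S,+,\cdot,0,1)$ such that $(S,+,0)$ and $(S,\cdot,1)$ are commutative monoids, multiplication distributes over addition, and $s\cdot 0=0$ for all $s\in S$. An element $s\in S$ is a unit if $st=1$ for some $t\in S$. An element $s\in S$ is multiplicatively cancellative if $sx_1=sx_2$ implies $x_1=x_2$ for all $x_1,x_2\in S$; otherwise it is multiplicatively non-cancellative. A semiring $S$ is $\pi$-regular if for every $s\in S$ there are $t\in S$ and a positive integer $n$ such that $s^{n+1}t=s^n$. *)

theory Defs
  imports "HOL-Algebra.Ring"
begin

text \<open>The library locale \<^locale>\<open>semiring\<close> does not require multiplication to be
  commutative. As in the library, the trivial semiring (where zero equals one) is not excluded.\<close>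

locale comm_semiring_struct = semiring S + comm_monoid S for S (structure)

locale pi_regular_semiring = comm_semiring_struct +
  assumes pi_regular:
    "s \<in> carrier S \<Longrightarrow> \<exists>t\<in>carrier S. \<exists>n::nat. n > 0 \<and> s [^] (n + 1) \<otimes> t = s [^] n"

definition mult_cancellative :: "('a, 'm) ring_scheme \<Rightarrow> 'a \<Rightarrow> bool" where
  "mult_cancellative S s \<longleftrightarrow>
    (\<forall>x\<^sub>1\<in>carrier S. \<forall>x\<^sub>2\<in>carrier S. s \<otimes>\<^bsub>S\<^esub> x\<^sub>1 = s \<otimes>\<^bsub>S\<^esub> x\<^sub>2 \<longrightarrow> x\<^sub>1 = x\<^sub>2)"

text \<open>Units are always cancellative, so in a disjunction ``unit or non-cancellative'' the two
  alternatives exclude each other.\<close>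

lemma (in comm_semiring_struct) Units_mult_cancellative:
  "s \<in> Units S \<Longrightarrow> mult_cancellative S s"
  by (simp add: mult_cancellative_def)

end

theory Submission
  imports Defs
begin

text \<open>If \<open>s\<close> is cancellative, then so is each of its powers. Pi-regularity gives \<open>t\<close> and \<open>n\<close> with
  \<open>s\<^sup>n (s t) = s\<^sup>n 1\<close>, and cancelling \<open>s\<^sup>n\<close> leaves \<open>s t = 1\<close>, so \<open>s\<close> is a unit.\<close>

lemma (in comm_semiring_struct) mult_cancellative_pow:
  fixes n :: nat
  assumes s: "s \<in> carrier S" and canc: "mult_cancellative S s"
  shows "mult_cancellative S (s [^] n)"
proof (induction n)
  case 0
  then show ?case by (simp add: mult_cancellative_def)
next
  case (Suc n)
  have "x = y" if xy: "x \<in> carrier S" "y \<in> carrier S" "s [^] Suc n \<otimes> x = s [^] Suc n \<otimes> y" for x y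
  proof -
    have "s [^] n \<otimes> (s \<otimes> x) = s [^] n \<otimes> (s \<otimes> y)"
      using s xy by (simp add: m_assoc)
    then have "s \<otimes> x = s \<otimes> y"
      using Suc.IH s xy(1,2) unfolding mult_cancellative_def by blast
    then show "x = y"
      using canc xy(1,2) unfolding mult_cancellative_def by blast
  qed
  then show ?case unfolding mult_cancellative_def by blast
qed

theorem proposition2p2:
  fixes S :: "('a, 'm) ring_scheme"
  assumes "pi_regular_semiring S"
  shows "\<forall>s\<in>carrier S. s \<in> Units S \<or> \<not> mult_cancellative S s"
proof -
  interpret pi_regular_semiring S by (fact assms)
  have "s \<in> Units S" if s: "s \<in> carrier S" and canc: "mult_cancellative S s" for s
  proof -
    obtain t and n :: nat where t: "t \<in> carrier S"
      and reg: "s [^]\<^bsub>S\<^esub> (n + 1) \<otimes>\<^bsub>S\<^esub> t = s [^]\<^bsub>S\<^esub> n"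
      using pi_regular[OF s] by blast
    have "s [^]\<^bsub>S\<^esub> n \<otimes>\<^bsub>S\<^esub> (s \<otimes>\<^bsub>S\<^esub> t) = s [^]\<^bsub>S\<^esub> n \<otimes>\<^bsub>S\<^esub> \<one>\<^bsub>S\<^esub>"
      using reg s t by (simp add: m_assoc)
    then have "s \<otimes>\<^bsub>S\<^esub> t = \<one>\<^bsub>S\<^esub>"
      using mult_cancellative_pow[OF s canc, of n] s t
      unfolding mult_cancellative_def by blast
    moreover from this have "t \<otimes>\<^bsub>S\<^esub> s = \<one>\<^bsub>S\<^esub>"
      using s t by (simp add: m_comm)
    ultimately show "s \<in> Units S"
      using s t unfolding Units_def by blast
  qed
  then show ?thesis by blast
qed

end
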